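(* Let $f\colon\mathbb{R}_+\times X\rightarrow X$ be a $C^0$-semi flow on a compact metric space $(X,d)$, and let $x\in X$ be such that $\mathcal{C}_x$ is not generic. If the Birkhoff recurrent points of $f$ are dense in $\mathcal{C}_x$, then $f$ has sensitive dependence on initial data near $\mathcal{C}_x$ in the following sense: there exists a constant $\epsilon>0$ such that for any $a\in X$, any $\hat{x}\in\mathcal{C}_x$ and any neighborhood $U$ of $\hat{x}$ in $X$, there exists some point $c\in U$ with $$\limsup_{t\to+\infty}d\big(f(t,a), f(t,c)\big)\ge\epsilon.$$
   Context: $\mathbb{R}_+=[0,\infty)$. A $C^0$-semi flow on $X$ is a map $f\colon\mathbb{R}_+\times X\to X$ such that $f(0,x)=x$ for all $x$; $f$ is jointly continuous; and $f(t_2,f(t_1,x))=f(t_1+t_2,x)$ for all $x\in X$, $t_1,t_2\in\mathbb{R}_+$. A closed set $C\subseteq X$ is a center of attraction of the motion $f(t,x)$ if $\lim_{T\to+\infty}\frac1T\int_0^T\mathds{1}_{B_\varepsilon(C)}(f(t,x))\,dt=1$ for every $\varepsilon>0$, where $B_\varepsilon(C)$ is the $\varepsilon$-neighborhood of $C$ in $X$. The minimal center of attraction $\mathcal{C}_x$ of $f(t,x)$ is a center of attraction having no proper subset that is also a center of attraction of $f(t,x)$; it exists for every $x$ since $X$ is compact. A set $\Lambda\subseteq X$ is $f$-invariant if $f(t,y)\in\Lambda$ for all $y\in\Lambda$, $t\ge0$. An $f$-invariant set $\Lambda$ is generic if there exists $y\in\Lambda$ with $\Lambda=\mathcal{C}_y$.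 (Minimal centers of attraction are $f$-invariant.) A minimal set is a nonempty closed $f$-invariant set having no proper nonempty closed $f$-invariant subset. A point $y\in X$ (or its motion $f(t,y)$) is Birkhoff recurrent if the orbit closure $\overline{\mathcal{O}_f(y)}$, $\mathcal{O}_f(y)=f(\mathbb{R}_+,y)$, is minimal. "The Birkhoff recurrent points are dense in $\mathcal{C}_x$" means that the set of Birkhoff recurrent points lying in $\mathcal{C}_x$ is dense in $\mathcal{C}_x$. *)

theory Defs
  imports "HOL-Analysis.Analysis"
begin

text \<open>
  The phase space is the whole type \<open>'a\<close>, with compactness of \<open>UNIV\<close> assumed where needed.
  Flows are total functions of a real time, but only times \<open>t \<ge> 0\<close> are ever constrained or used.
\<close>

definition semiflow :: "(real \<Rightarrow> 'a::metric_space \<Rightarrow> 'a) \<Rightarrow> bool" where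
  "semiflow f \<longleftrightarrow>
     (\<forall>x. f 0 x = x) \<and>
     continuous_on ({0..} \<times> UNIV) (\<lambda>(t, x). f t x) \<and>
     (\<forall>x. \<forall>t1\<ge>0. \<forall>t2\<ge>0. f t2 (f t1 x) = f (t1 + t2) x)"

text \<open>
  A union of balls rather than \<open>{y. infdist y C < \<epsilon>}\<close>: since \<open>infdist y {} = 0\<close>, the latter
  would turn the empty set into a center of attraction.
\<close>

definition nbhd :: "real \<Rightarrow> 'a::metric_space set \<Rightarrow> 'a set" where
  "nbhd \<epsilon> C = (\<Union>c\<in>C. ball c \<epsilon>)"

definition center_of_attraction ::
    "(real \<Rightarrow> 'a::metric_space \<Rightarrow> 'a) \<Rightarrow> 'a \<Rightarrow> 'a set \<Rightarrow> bool" where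
  "center_of_attraction f x C \<longleftrightarrow>
     closed C \<and>
     (\<forall>\<epsilon>>0. ((\<lambda>T. 1 / T * (LBINT t:{0..T}. indicat_real (nbhd \<epsilon> C) (f t x))) \<longlongrightarrow> 1) at_top)"

definition is_minimal_center ::
    "(real \<Rightarrow> 'a::metric_space \<Rightarrow> 'a) \<Rightarrow> 'a \<Rightarrow> 'a set \<Rightarrow> bool" where
  "is_minimal_center f x C \<longleftrightarrow>
     center_of_attraction f x C \<and> (\<nexists>C'. C' \<subset> C \<and> center_of_attraction f x C')"

text \<open>
  For a semiflow on a compact space exactly one minimal center exists: the set of all \<open>y\<close> each of
  whose neighborhoods is visited by the motion of \<open>x\<close> with positive upper frequency.
\<close>

definition minimal_center :: "(real \<Rightarrow> 'a::metric_space \<Rightarrow> 'a) \<Rightarrow> 'a \<Rightarrow> 'a set" where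
  "minimal_center f x = (THE C. is_minimal_center f x C)"

definition flow_invariant :: "(real \<Rightarrow> 'a \<Rightarrow> 'a) \<Rightarrow> 'a set \<Rightarrow> bool" where
  "flow_invariant f \<Lambda> \<longleftrightarrow> (\<forall>y\<in>\<Lambda>. \<forall>t\<ge>0. f t y \<in> \<Lambda>)"

definition generic :: "(real \<Rightarrow> 'a::metric_space \<Rightarrow> 'a) \<Rightarrow> 'a set \<Rightarrow> bool" where
  "generic f \<Lambda> \<longleftrightarrow> flow_invariant f \<Lambda> \<and> (\<exists>y\<in>\<Lambda>. \<Lambda> = minimal_center f y)"

definition minimal_set :: "(real \<Rightarrow> 'a::metric_space \<Rightarrow> 'a) \<Rightarrow> 'a set \<Rightarrow> bool" where
  "minimal_set f M \<longleftrightarrow>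
     M \<noteq> {} \<and> closed M \<and> flow_invariant f M \<and>
     (\<nexists>N. N \<subset> M \<and> N \<noteq> {} \<and> closed N \<and> flow_invariant f N)"

definition orbit :: "(real \<Rightarrow> 'a \<Rightarrow> 'a) \<Rightarrow> 'a \<Rightarrow> 'a set" where
  "orbit f y = (\<lambda>t. f t y) ` {0..}"

definition birkhoff_recurrent :: "(real \<Rightarrow> 'a::metric_space \<Rightarrow> 'a) \<Rightarrow> 'a \<Rightarrow> bool" where
  "birkhoff_recurrent f y \<longleftrightarrow> minimal_set f (closure (orbit f y))"

end

theory Submission
  imports Defs
begin

text \<open>
  The minimal center \<open>C\<close> of \<open>x\<close> is the intersection of all centers of attraction; it is nonempty,
  closed and invariant, and the motion of \<open>x\<close> comes back to every neighborhood of each of its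
  points at arbitrarily large times. A minimal set is the minimal center of each of its points, so
  a non-generic \<open>C\<close> is not minimal, and density of the recurrent points yields two disjoint minimal
  sets in \<open>C\<close>, one of which, \<open>M\<close>, stays away from the given point of \<open>C\<close>. Near that point lie a
  recurrent point, returning there with bounded gaps, and a point of the orbit of \<open>x\<close>, shadowing
  \<open>M\<close> infinitely often for longer than any such gap. These two motions keep separating, so the
  motion of any \<open>a\<close> keeps separating from one of them.
\<close>

section \<open>Sets of times of full density\<close>

text \<open>Asymptotic density 1 on the half-line. Measurability is built in, so that intersections
  and shifts carry it along.\<close>

definition full_density :: "real set \<Rightarrow> bool" where
  "full_density A \<longleftrightarrow> A \<in> sets borel \<and> ((\<lambda>T. measure lborel (A \<inter> {0..T}) / T) \<longlongrightarrow> 1) at_top"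

lemma fmeasurable_Int_Icc [simp]:
  fixes A :: "real set"
  assumes "A \<in> sets borel"
  shows "A \<inter> {a..b} \<in> fmeasurable lborel"
  using fmeasurable_cbox[of a b] assms by (auto intro: fmeasurableI2[of "cbox a b"])

lemma measure_Int_Icc_le:
  assumes "A \<in> sets borel" "0 \<le> T"
  shows "measure lborel (A \<inter> {0..T}) \<le> T"
proof -
  have "measure lborel (A \<inter> {0..T}) \<le> measure lborel {0..T}"
    using assms fmeasurable_cbox[of 0 T] by (intro measure_mono_fmeasurable) auto
  then show ?thesis using assms by simp
qed

text \<open>The quotient never exceeds 1 for \<open>T > 0\<close>, so squeezing leaves only a lower
  bound to be supplied.\<close>

lemma full_densityI_lower_bound:
  assumes "A \<in> sets borel" "(g \<longlongrightarrow> 1) at_top"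
    and "\<And>T. T > 0 \<Longrightarrow> g T \<le> measure lborel (A \<inter> {0..T}) / T"
  shows "full_density A"
  unfolding full_density_def
proof (intro conjI tendsto_sandwich[OF _ _ assms(2) tendsto_const])
  show "\<forall>\<^sub>F T in at_top. g T \<le> measure lborel (A \<inter> {0..T}) / T"
    using eventually_gt_at_top[of 0] by eventually_elim (rule assms(3))
  show "\<forall>\<^sub>F T in at_top. measure lborel (A \<inter> {0..T}) / T \<le> 1"
    using eventually_gt_at_top[of 0]
  proof eventually_elim
    case (elim T)
    then show ?case using measure_Int_Icc_le[OF assms(1), of T] by simp
  qed
qed (fact assms(1))

lemma full_density_mono:
  assumes "full_density A" "A \<subseteq> B" "B \<in> sets borel"
  shows "full_density B"
proof (rule full_densityI_lower_bound[OF assms(3)])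
  show "((\<lambda>T. measure lborel (A \<inter> {0..T}) / T) \<longlongrightarrow> 1) at_top"
    using assms(1) by (simp add: full_density_def)
  show "measure lborel (A \<inter> {0..T}) / T \<le> measure lborel (B \<inter> {0..T}) / T" if "T > 0" for T
  proof (rule divide_right_mono)
    show "measure lborel (A \<inter> {0..T}) \<le> measure lborel (B \<inter> {0..T})"
      using assms by (intro measure_mono_fmeasurable) (auto simp: full_density_def)
  qed (use that in simp)
qed

text \<open>Inclusion-exclusion with the trivial bound \<open>T\<close> on the union. This is why
  two centers of attraction can be intersected.\<close>

lemma full_density_Int:
  assumes "full_density A" "full_density B"
  shows "full_density (A \<inter> B)"
proof -
  have m: "A \<in> sets borel" "B \<in> sets borel" using assms by (auto simp: full_density_def)
  let ?m = "\<lambda>A T. measure lborel (A \<inter> {0..T})"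
  show ?thesis
  proof (rule full_densityI_lower_bound)
    have "((\<lambda>T. ?m A T / T + ?m B T / T - 1) \<longlongrightarrow> 1 + 1 - 1) at_top"
      using assms by (intro tendsto_intros) (auto simp: full_density_def)
    then show "((\<lambda>T. ?m A T / T + ?m B T / T - 1) \<longlongrightarrow> 1) at_top" by simp
    fix T :: real assume "T > 0"
    have "?m (A \<union> B) T = ?m A T + ?m B T - ?m (A \<inter> B) T"
      using measure_Un3[of "A \<inter> {0..T}" lborel "B \<inter> {0..T}"] m
      by (simp add: Int_Un_distrib2 Int_ac)
    moreover have "?m (A \<union> B) T \<le> T"
      using measure_Int_Icc_le[of "A \<union> B" T] m \<open>T > 0\<close> by auto
    ultimately have "(?m A T + ?m B T - T) / T \<le> ?m (A \<inter> B) T / T"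
      using \<open>T > 0\<close> by (intro divide_right_mono) auto
    then show "?m A T / T + ?m B T / T - 1 \<le> ?m (A \<inter> B) T / T"
      using \<open>T > 0\<close> by (simp add: add_divide_distrib diff_divide_distrib)
  qed (use m in auto)
qed

lemma full_density_atLeast:
  assumes "0 \<le> S"
  shows "full_density {S..}"
proof (rule full_densityI_lower_bound)
  have "((\<lambda>T. 1 - S / T) \<longlongrightarrow> 1 - 0) at_top"
    by (intro tendsto_intros real_tendsto_divide_at_top[OF tendsto_const] filterlim_ident)
  then show "((\<lambda>T. 1 - S / T) \<longlongrightarrow> 1) at_top" by simp
  show "1 - S / T \<le> measure lborel ({S..} \<inter> {0..T}) / T" if "T > 0" for T
  proof -
    have "{S..} \<inter> {0..T} = {S..T}" using assms by auto
    then show ?thesis using that by (cases "S \<le> T") (auto simp: field_simps)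
  qed
qed auto

lemma not_full_density_empty: "\<not> full_density {}"
  by (auto simp: full_density_def tendsto_const_iff)

text \<open>Shifting by \<open>s\<close> loses at most the piece of \<open>A\<close> in
  \<open>{0..s}\<close>, whose length is negligible against \<open>T\<close>.\<close>

lemma full_density_shift:
  assumes "full_density A" "0 \<le> s"
  shows "full_density {t. t + s \<in> A}"
proof -
  have m: "A \<in> sets borel" using assms by (auto simp: full_density_def)
  have "(\<lambda>t. t + s) -` A \<inter> space borel \<in> sets borel"
    using m by (intro measurable_sets) auto
  then have m': "{t. t + s \<in> A} \<in> sets borel" by (simp add: vimage_def)
  let ?m = "\<lambda>A T. measure lborel (A \<inter> {0..T})"
  show ?thesis
  proof (rule full_densityI_lower_bound[OF m'])
    have "((\<lambda>T. ?m A T / T - s / T) \<longlongrightarrow> 1 - 0) at_top"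
      using assms by (intro tendsto_intros real_tendsto_divide_at_top[OF tendsto_const] filterlim_ident)
        (auto simp: full_density_def)
    then show "((\<lambda>T. ?m A T / T - s / T) \<longlongrightarrow> 1) at_top" by simp
    fix T :: real assume "T > 0"
    let ?B = "{t. t + s \<in> A} \<inter> {0..T}"
    have eq: "(+) s ` ?B = A \<inter> {s..T+s}"
    proof
      show "A \<inter> {s..T+s} \<subseteq> (+) s ` ?B"
      proof
        fix t assume "t \<in> A \<inter> {s..T+s}"
        then show "t \<in> (+) s ` ?B" by (intro image_eqI[of _ _ "t - s"]) auto
      qed
    qed (auto simp: add.commute)
    have tr: "measure lborel ((+) s ` ?B) = ?m {t. t + s \<in> A} T"
      using m m' measure_translation[of s ?B] by (simp add: eq)
    \<comment> \<open>Here \<open>A \<inter> {0..T}\<close> is split at time \<open>s\<close>; the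
      later piece is the translate of \<open>?B\<close>.\<close>
    have "?m A T \<le> measure lborel ({0..s} \<union> (A \<inter> {s..T+s}))"
      using m assms fmeasurable_cbox[of 0 s] by (intro measure_mono_fmeasurable fmeasurable.Un) auto
    also have "\<dots> \<le> measure lborel {0..s} + measure lborel (A \<inter> {s..T+s})"
      using m by (intro measure_Un_le) auto
    also have "\<dots> = s + ?m {t. t + s \<in> A} T" using tr eq assms by simp
    finally have "(?m A T - s) / T \<le> ?m {t. t + s \<in> A} T / T"
      using \<open>T > 0\<close> by (intro divide_right_mono) auto
    then show "?m A T / T - s / T \<le> ?m {t. t + s \<in> A} T / T"
      by (simp add: diff_divide_distrib)
  qed
qed

section \<open>Minimal centers of attraction\<close>

text \<open>A Lebesgue number of the one-element cover \<open>{V}\<close> of \<open>C\<close> serves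
  as the radius.\<close>

lemma nbhd_subset_open:
  assumes "compact C" "open V" "C \<subseteq> V"
  obtains e where "e > 0" "nbhd e C \<subseteq> V"
proof -
  obtain e where e: "e > 0" "\<And>x. x \<in> C \<Longrightarrow> \<exists>G\<in>{V}. ball x e \<subseteq> G"
    by (rule Heine_Borel_lemma[OF assms(1), of "{V}"]) (use assms in auto)
  show ?thesis
    by (rule that[OF e(1)]) (use e(2) in \<open>auto simp: nbhd_def\<close>)
qed

lemma open_meets_closure: "open V \<Longrightarrow> y \<in> V \<Longrightarrow> y \<in> closure S \<Longrightarrow> V \<inter> S \<noteq> {}"
  using open_Int_closure_eq_empty[of V S] by blast

section \<open>Compact semiflows: continuity and times of visit\<close>

locale compact_semiflow =
  fixes f :: "real \<Rightarrow> 'a::metric_space \<Rightarrow> 'a"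
  assumes compact_space: "compact (UNIV :: 'a set)"
    and flow: "semiflow f"
begin

lemma flow_zero [simp]: "f 0 y = y"
  using flow by (simp add: semiflow_def)

lemma flow_add: "0 \<le> s \<Longrightarrow> 0 \<le> t \<Longrightarrow> f t (f s y) = f (s + t) y"
  using flow by (simp add: semiflow_def)

lemma compact_if_closed: "closed A \<Longrightarrow> compact (A :: 'a set)"
  using compact_Int_closed[OF compact_space, of A] by simp

lemma continuous_on_flow: "continuous_on ({0..} \<times> UNIV) (\<lambda>z. f (fst z) (snd z))"
  using flow by (simp add: semiflow_def case_prod_unfold)

lemma continuous_on_time: "continuous_on {0..} (\<lambda>t. f t y)"
  using continuous_on_compose2[OF continuous_on_flow, of "{0..}" "\<lambda>t. (t, y)"]
  by (simp add: continuous_on_Pair image_subset_iff)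

lemma continuous_on_space: "0 \<le> t \<Longrightarrow> continuous_on UNIV (f t)"
  using continuous_on_compose2[OF continuous_on_flow, of UNIV "\<lambda>y. (t, y)"]
  by (simp add: continuous_on_Pair image_subset_iff)

lemma open_flow_vimage: "0 \<le> t \<Longrightarrow> open V \<Longrightarrow> open (f t -` V)"
  by (intro open_vimage continuous_on_space)

lemma closed_flow_vimage: "0 \<le> t \<Longrightarrow> closed C \<Longrightarrow> closed (f t -` C)"
  by (intro closed_vimage continuous_on_space)

text \<open>Negative times are cut off because continuity of the motion, and with it measurability,
  is known only for \<open>t \<ge> 0\<close>.\<close>

definition visits :: "'a \<Rightarrow> 'a set \<Rightarrow> real set" where
  "visits y V = {t. 0 \<le> t \<and> f t y \<in> V}"

lemma visits_borel:
  assumes "open V"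
  shows "visits y V \<in> sets borel"
proof -
  obtain W where W: "open W" "W \<inter> {0..} = (\<lambda>t. f t y) -` V \<inter> {0..}"
    using continuous_on_time[of y] assms unfolding continuous_on_open_invariant by metis
  have "visits y V = W \<inter> {0..}"
    unfolding W(2) by (auto simp: visits_def)
  then show ?thesis using W(1) by simp
qed

lemma frequency_eq:
  assumes "open V"
  shows "(LBINT t:{0..T}. indicat_real V (f t y)) = measure lborel (visits y V \<inter> {0..T})"
proof -
  have "(LBINT t:{0..T}. indicat_real V (f t y)) = (LBINT t. indicat_real (visits y V \<inter> {0..T}) t)"
    unfolding set_lebesgue_integral_def
    by (rule Bochner_Integration.integral_cong) (auto simp: visits_def indicator_def)
  then show ?thesis by simp
qed

lemma open_nbhd: "open (nbhd e C)" for C :: "'a set"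
  by (auto simp: nbhd_def)

lemma nbhd_superset: "e > 0 \<Longrightarrow> C \<subseteq> nbhd e C" for C :: "'a set"
  by (force simp: nbhd_def)

text \<open>On a compact space every open superset of a closed \<open>C\<close> contains some
  \<open>nbhd e C\<close>. Open supersets suit preimages and finite intersections better than metric
  neighborhoods.\<close>

lemma center_of_attraction_iff:
  "center_of_attraction f y C \<longleftrightarrow>
     closed C \<and> (\<forall>V. open V \<longrightarrow> C \<subseteq> V \<longrightarrow> full_density (visits y V))"
proof -
  have full: "((\<lambda>T. 1 / T * (LBINT t:{0..T}. indicat_real V (f t y))) \<longlongrightarrow> 1) at_top
      \<longleftrightarrow> full_density (visits y V)" if "open V" for V
    using that by (simp add: full_density_def visits_borel frequency_eq)
  have "full_density (visits y V)"
    if C: "closed C" "\<And>e. e > 0 \<Longrightarrow> full_density (visits y (nbhd e C))"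
      and V: "open V" "C \<subseteq> V" for V
  proof -
    obtain e where e: "e > 0" "nbhd e C \<subseteq> V"
      using nbhd_subset_open[OF compact_if_closed] C(1) V by blast
    show ?thesis
      by (rule full_density_mono[OF C(2)[OF e(1)]])
        (use e(2) visits_borel[OF V(1)] in \<open>auto simp: visits_def\<close>)
  qed
  then show ?thesis
    unfolding center_of_attraction_def full[OF open_nbhd]
    using open_nbhd nbhd_superset by meson
qed

lemma full_density_visits:
  "center_of_attraction f y C \<Longrightarrow> open V \<Longrightarrow> C \<subseteq> V \<Longrightarrow> full_density (visits y V)"
  unfolding center_of_attraction_iff by blast

lemma center_of_attraction_closed: "center_of_attraction f y C \<Longrightarrow> closed C"
  by (simp add: center_of_attraction_def)

lemma center_of_attraction_Int:
  assumes "center_of_attraction f y C" "center_of_attraction f y D"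
  shows "center_of_attraction f y (C \<inter> D)"
  unfolding center_of_attraction_iff
proof (intro conjI allI impI)
  have cl: "closed C" "closed D" using assms center_of_attraction_closed by blast+
  then show "closed (C \<inter> D)" by (rule closed_Int)
  fix V assume V: "open V" "C \<inter> D \<subseteq> V"
  \<comment> \<open>A Lebesgue number of the cover of \<open>C\<close> by \<open>V\<close> and
    \<open>- D\<close>: a ball of radius \<open>e\<close> about a point of \<open>C\<close> that
    meets \<open>D\<close> must lie in \<open>V\<close>. Hence a point within \<open>e / 2\<close>
    of both sets is in \<open>V\<close>.\<close>
  obtain e where e: "e > 0" "\<And>c. c \<in> C \<Longrightarrow> \<exists>G\<in>{V, - D}. ball c e \<subseteq> G"
    by (rule Heine_Borel_lemma[OF compact_if_closed[OF cl(1)], of "{V, - D}"])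
      (use V cl in auto)
  define P Q where "P = nbhd (e / 2) C" and "Q = nbhd (e / 2) D"
  have PQ: "open P" "open Q" "C \<subseteq> P" "D \<subseteq> Q"
    using e(1) nbhd_superset[of "e / 2"] by (simp_all add: P_def Q_def open_nbhd)
  have "P \<inter> Q \<subseteq> V"
  proof
    fix u assume "u \<in> P \<inter> Q"
    then obtain c z where cz: "c \<in> C" "z \<in> D" "dist c u < e / 2" "dist z u < e / 2"
      unfolding P_def Q_def nbhd_def by auto
    then have "z \<in> ball c e" "u \<in> ball c e"
      using dist_triangle2[of c z u] e(1) by auto
    then show "u \<in> V" using e(2)[OF cz(1)] cz(2) by blast
  qed
  have "full_density (visits y P \<inter> visits y Q)"
    using PQ by (intro full_density_Int full_density_visits[OF assms(1)] full_density_visits[OF assms(2)])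
  then show "full_density (visits y V)"
    by (rule full_density_mono)
      (use \<open>P \<inter> Q \<subseteq> V\<close> visits_borel[OF V(1)] in \<open>auto simp: visits_def\<close>)
qed

text \<open>From time \<open>S\<close> on the motion is inside its own tail, and
  \<open>{S..}\<close> has full density.\<close>

lemma center_of_attraction_closure_tail:
  assumes "0 \<le> S"
  shows "center_of_attraction f y (closure ((\<lambda>t. f t y) ` {S..}))"
  unfolding center_of_attraction_iff
proof (intro conjI allI impI)
  fix V assume V: "open V" "closure ((\<lambda>t. f t y) ` {S..}) \<subseteq> V"
  have "(\<lambda>t. f t y) ` {S..} \<subseteq> V" using order_trans[OF closure_subset V(2)] .
  then have "{S..} \<subseteq> visits y V"
    using assms by (simp add: visits_def subset_iff)
  then show "full_density (visits y V)"
    by (rule full_density_mono[OF full_density_atLeast[OF assms] _ visits_borel[OF V(1)]])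
qed (rule closed_closure)

text \<open>For open \<open>V\<close> containing the intersection, compactness of \<open>- V\<close>
  yields finitely many centers whose intersection is already inside \<open>V\<close>; binary
  intersections then suffice.\<close>

lemma center_of_attraction_Inter:
  "center_of_attraction f y (\<Inter>{C. center_of_attraction f y C})"
  unfolding center_of_attraction_iff[where C = "\<Inter>_"]
proof (intro conjI allI impI)
  let ?\<C> = "{C. center_of_attraction f y C}"
  show "closed (\<Inter>?\<C>)" by (intro closed_Inter) (auto intro: center_of_attraction_closed)
  fix V assume V: "open V" "\<Inter>?\<C> \<subseteq> V"
  have "compact (- V)" by (intro compact_if_closed closed_Compl V(1))
  moreover have "\<And>C. C \<in> ?\<C> \<Longrightarrow> closed C" by (auto intro: center_of_attraction_closed)
  moreover have "- V \<inter> \<Inter>?\<C> = {}" using V(2) by blast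
  ultimately obtain F where F: "finite F" "F \<subseteq> ?\<C>" "- V \<inter> \<Inter>F = {}"
    using compact_imp_fip[of "- V" ?\<C>] by metis
  have "center_of_attraction f y (\<Inter>F)" using F(1,2)
  proof (induction F)
    \<comment> \<open>The empty subfamily has intersection \<open>UNIV\<close>, so the whole space
      has to be a center too.\<close>
    case empty
    have "full_density (visits y UNIV)"
      by (rule full_density_visits[OF center_of_attraction_closure_tail[OF order_refl]]) auto
    then have "full_density (visits y V)" if "UNIV \<subseteq> V" for V
      using that by (simp add: top.extremum_unique)
    then show ?case
      unfolding center_of_attraction_iff by simp
  next
    case (insert C F)
    then show ?case using center_of_attraction_Int by simp
  qed
  moreover have "\<Inter>F \<subseteq> V" using F(3) by auto
  ultimately show "full_density (visits y V)"
    using V(1) by (intro full_density_visits)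
qed

text \<open>The intersection is itself a center and lies below every other one, so it is the unique
  minimal center and the definite description is meaningful.\<close>

lemma minimal_center_eq_Inter: "minimal_center f y = \<Inter>{C. center_of_attraction f y C}"
  unfolding minimal_center_def
proof (rule the_equality)
  show "is_minimal_center f y (\<Inter>{C. center_of_attraction f y C})"
    using center_of_attraction_Inter[of y] unfolding is_minimal_center_def by blast
  show "C = \<Inter>{C. center_of_attraction f y C}" if "is_minimal_center f y C" for C
  proof -
    have "center_of_attraction f y C" "\<nexists>C'. C' \<subset> C \<and> center_of_attraction f y C'"
      using that by (simp_all add: is_minimal_center_def)
    moreover from this(1) have "\<Inter>{C. center_of_attraction f y C} \<subseteq> C" by blast
    ultimately show ?thesis using center_of_attraction_Inter[of y] by (metis psubsetI)
  qed
qed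

lemma center_of_attraction_minimal_center: "center_of_attraction f y (minimal_center f y)"
  by (simp add: minimal_center_eq_Inter center_of_attraction_Inter)

lemma minimal_center_subset: "center_of_attraction f y C \<Longrightarrow> minimal_center f y \<subseteq> C"
  by (auto simp: minimal_center_eq_Inter)

lemma closed_minimal_center: "closed (minimal_center f y)"
  by (rule center_of_attraction_closed[OF center_of_attraction_minimal_center])

text \<open>Otherwise \<open>{}\<close> would be an open superset of the center, visited with full
  density.\<close>

lemma minimal_center_nonempty: "minimal_center f y \<noteq> {}"
proof
  assume "minimal_center f y = {}"
  then have "full_density (visits y {})"
    using full_density_visits[OF center_of_attraction_minimal_center[of y], of "{}"] by simp
  then show False by (simp add: visits_def not_full_density_empty)
qed

text \<open>The preimage of the center under \<open>f s\<close> is again a center of attraction, so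
  it contains the minimal one.\<close>

lemma flow_invariant_minimal_center: "flow_invariant f (minimal_center f y)"
  unfolding flow_invariant_def
proof (intro ballI allI impI)
  fix z s assume z: "z \<in> minimal_center f y" and s: "(0::real) \<le> s"
  let ?C = "minimal_center f y"
  have "center_of_attraction f y (f s -` ?C)"
    unfolding center_of_attraction_iff[where C = "f s -` ?C"]
  proof (intro conjI allI impI)
    show "closed (f s -` ?C)" using s closed_minimal_center by (rule closed_flow_vimage)
    fix V assume V: "open V" "f s -` ?C \<subseteq> V"
    \<comment> \<open>The points all of whose preimages under \<open>f s\<close> lie in
      \<open>V\<close>. Being in \<open>?W\<close> at time \<open>t + s\<close> forces the motion
      into \<open>V\<close> at time \<open>t\<close>.\<close>
    let ?W = "- f s ` (- V)"
    have "compact (f s ` (- V))"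
      by (intro compact_continuous_image compact_if_closed closed_Compl V(1)
          continuous_on_subset[OF continuous_on_space[OF s]]) auto
    then have "open ?W" by (simp add: compact_imp_closed open_Compl)
    moreover have "?C \<subseteq> ?W" using V by auto
    ultimately have "full_density (visits y ?W)"
      by (rule full_density_visits[OF center_of_attraction_minimal_center])
    \<comment> \<open>The shifted set may contain times in \<open>{-s..<0}\<close>, which are not
      times of visit; the intersection with \<open>{0..}\<close> removes them.\<close>
    then have "full_density ({t. t + s \<in> visits y ?W} \<inter> {0..})"
      using s by (intro full_density_Int full_density_shift full_density_atLeast) auto
    moreover have "{t. t + s \<in> visits y ?W} \<inter> {0..} \<subseteq> visits y V"
    proof
      fix t assume "t \<in> {t. t + s \<in> visits y ?W} \<inter> {0..}"
      then have "0 \<le> t" "f s (f t y) \<notin> f s ` (- V)"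
        using s by (simp_all add: visits_def flow_add)
      then show "t \<in> visits y V" unfolding visits_def by blast
    qed
    ultimately show "full_density (visits y V)"
      by (rule full_density_mono) (rule visits_borel[OF V(1)])
  qed
  then show "f s z \<in> ?C" using minimal_center_subset z by blast
qed

section \<open>Minimal sets\<close>

lemma orbit_self: "y \<in> orbit f y"
  unfolding orbit_def by (rule image_eqI[of _ _ 0]) simp_all

lemma closure_orbit_self: "y \<in> closure (orbit f y)"
  using closure_subset orbit_self by (rule subsetD)

lemma orbit_closure_subset:
  assumes "closed A" "flow_invariant f A" "y \<in> A"
  shows "closure (orbit f y) \<subseteq> A"
  using assms by (intro closure_minimal) (auto simp: orbit_def flow_invariant_def)

lemma flow_invariant_closure_orbit: "flow_invariant f (closure (orbit f y))"
  unfolding flow_invariant_def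
proof (intro ballI allI impI)
  fix z t assume z: "z \<in> closure (orbit f y)" and t: "(0::real) \<le> t"
  have "f t ` closure (orbit f y) \<subseteq> closure (orbit f y)"
  proof (rule image_closure_subset)
    show "continuous_on (closure (orbit f y)) (f t)"
      using continuous_on_space[OF t] by (rule continuous_on_subset) simp
    show "f t ` orbit f y \<subseteq> closure (orbit f y)"
    proof -
      have "f t (f s y) \<in> orbit f y" if "0 \<le> s" for s
        unfolding orbit_def
        by (rule image_eqI[of _ _ "s + t"]) (use t that in \<open>simp_all add: flow_add\<close>)
      then have "f t ` orbit f y \<subseteq> orbit f y"
        unfolding image_subset_iff by (simp add: orbit_def)
      then show ?thesis using closure_subset by (rule order_trans)
    qed
  qed auto
  then show "f t z \<in> closure (orbit f y)" using z by blast
qed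

lemma minimal_setD:
  assumes "minimal_set f M"
  shows "M \<noteq> {}" "closed M" "flow_invariant f M"
  using assms by (simp_all add: minimal_set_def)

lemma minimal_set_unique:
  assumes "minimal_set f M" "N \<subseteq> M" "N \<noteq> {}" "closed N" "flow_invariant f N"
  shows "N = M"
  using assms unfolding minimal_set_def by (metis psubsetI)

lemma minimal_set_orbit_closure:
  assumes "minimal_set f M" "y \<in> M"
  shows "closure (orbit f y) = M"
proof -
  have "closure (orbit f y) \<subseteq> M"
    by (rule orbit_closure_subset[OF minimal_setD(2,3)[OF assms(1)] assms(2)])
  moreover have "closure (orbit f y) \<noteq> {}" using closure_orbit_self[of y] by force
  ultimately show ?thesis
    by (rule minimal_set_unique[OF assms(1) _ _ closed_closure flow_invariant_closure_orbit])
qed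

text \<open>For \<open>y\<close> in \<open>M\<close> the minimal center of \<open>y\<close> is a
  nonempty closed invariant subset of the orbit closure, hence of \<open>M\<close>, so minimality
  makes it all of \<open>M\<close>.\<close>

lemma generic_if_minimal_set:
  assumes "minimal_set f M"
  shows "generic f M"
proof -
  have M: "closed M" "flow_invariant f M" "M \<noteq> {}"
    using minimal_setD[OF assms] by simp_all
  then obtain y where y: "y \<in> M" by blast
  have "minimal_center f y \<subseteq> closure (orbit f y)"
    unfolding orbit_def by (intro minimal_center_subset center_of_attraction_closure_tail) simp
  also have "\<dots> \<subseteq> M" using M y by (intro orbit_closure_subset)
  finally have "minimal_center f y = M"
    by (rule minimal_set_unique[OF assms _ minimal_center_nonempty closed_minimal_center
          flow_invariant_minimal_center])
  then show ?thesis unfolding generic_def using M(2) y by blast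
qed

text \<open>If one minimal set in the center held all its recurrent points, density would make it
  the whole center, which would then be generic. A recurrent point outside it spans a second minimal
  set, and distinct minimal sets are disjoint.\<close>

lemma two_minimal_sets:
  assumes "\<not> generic f (minimal_center f x)"
    and dense: "minimal_center f x \<subseteq> closure {y \<in> minimal_center f x. birkhoff_recurrent f y}"
  obtains M N where "minimal_set f M" "minimal_set f N" "M \<inter> N = {}"
    "M \<subseteq> minimal_center f x" "N \<subseteq> minimal_center f x"
proof -
  let ?C = "minimal_center f x" and ?R = "{y \<in> minimal_center f x. birkhoff_recurrent f y}"
  have sub: "closure (orbit f y) \<subseteq> ?C" if "y \<in> ?C" for y
    using that closed_minimal_center flow_invariant_minimal_center by (intro orbit_closure_subset)
  have "?R \<noteq> {}" using dense minimal_center_nonempty[of x] by (metis closure_empty subset_empty)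
  then obtain p where p: "p \<in> ?R" by blast
  let ?M = "closure (orbit f p)"
  have M: "minimal_set f ?M" using p by (simp add: birkhoff_recurrent_def)
  have "?M \<noteq> ?C" using generic_if_minimal_set[OF M] assms(1) by metis
  then have "\<not> ?C \<subseteq> ?M" using sub p by auto
  then have "\<not> ?R \<subseteq> ?M" using dense closure_minimal[of ?R ?M] closed_closure by blast
  then obtain q where q: "q \<in> ?R" "q \<notin> ?M" by blast
  let ?N = "closure (orbit f q)"
  have N: "minimal_set f ?N" using q by (simp add: birkhoff_recurrent_def)
  have "?M \<inter> ?N = {}"
  proof (rule ccontr)
    assume "?M \<inter> ?N \<noteq> {}"
    then obtain z where "z \<in> ?M" "z \<in> ?N" by blast
    then have "?M = ?N"
      using minimal_set_orbit_closure M N by metis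
    then show False using q(2) closure_orbit_self[of q] by simp
  qed
  then show ?thesis using that[OF M N] sub p q(1) by simp
qed

text \<open>Every orbit in the minimal set is dense there and so enters \<open>V\<close>. By
  compactness finitely many entrance times serve all points, and the largest bounds the
  gaps.\<close>

lemma syndetic_return:
  assumes "birkhoff_recurrent f p" "open V" "p \<in> V"
  obtains L where "L \<ge> 0" "\<And>t. 0 \<le> t \<Longrightarrow> \<exists>s\<in>{0..L}. f (t + s) p \<in> V"
proof -
  let ?M = "closure (orbit f p)"
  have M: "minimal_set f ?M" using assms by (simp add: birkhoff_recurrent_def)
  have cover: "?M \<subseteq> (\<Union>s\<in>{0..}. f s -` V)"
  proof
    fix z assume "z \<in> ?M"
    then have "p \<in> closure (orbit f z)"
      using minimal_set_orbit_closure[OF M, of z] closure_orbit_self[of p] by simp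
    then have "V \<inter> orbit f z \<noteq> {}"
      using assms by (intro open_meets_closure)
    then obtain s where "s \<in> {0..}" "f s z \<in> V" unfolding orbit_def by blast
    then show "z \<in> (\<Union>s\<in>{0..}. f s -` V)" by (intro UN_I vimageI2)
  qed
  have "open (f s -` V)" if "s \<in> {0..}" for s
    using that assms(2) by (intro open_flow_vimage) simp_all
  then obtain K where K: "K \<subseteq> {0..}" "finite K" "?M \<subseteq> (\<Union>s\<in>K. f s -` V)"
    by (rule compactE_image[OF compact_if_closed[OF closed_closure] _ cover])
  \<comment> \<open>Inserting \<open>0\<close> makes the set nonempty and the maximum
    nonnegative.\<close>
  let ?L = "Max (insert 0 K)"
  show ?thesis
  proof
    show "?L \<ge> 0" using K by (intro Max_ge) auto
    fix t :: real assume t: "0 \<le> t"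
    have "f t p \<in> ?M"
      using t flow_invariant_closure_orbit[of p] closure_orbit_self[of p]
      unfolding flow_invariant_def by blast
    then obtain s where s: "s \<in> K" "f s (f t p) \<in> V" using K(3) by blast
    have "s \<le> ?L" using s(1) K(2) by (intro Max_ge) auto
    moreover have "0 \<le> s" using s(1) K(1) by auto
    ultimately have "0 \<le> s" "s \<le> ?L" by simp_all
    then show "\<exists>s\<in>{0..?L}. f (t + s) p \<in> V"
      using s(2) t by (intro bexI[of _ s]) (simp_all add: flow_add)
  qed
qed

section \<open>Sensitive dependence\<close>

text \<open>The closure of each tail of the motion is a center, so it contains the minimal
  one.\<close>

lemma minimal_center_visited:
  assumes "y \<in> minimal_center f x" "open V" "y \<in> V" "0 \<le> S"
  obtains t where "t \<ge> S" "f t x \<in> V"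
proof -
  have "y \<in> closure ((\<lambda>t. f t x) ` {S..})"
    using minimal_center_subset[OF center_of_attraction_closure_tail[OF assms(4)]] assms(1) by blast
  then have "V \<inter> (\<lambda>t. f t x) ` {S..} \<noteq> {}"
    using assms by (intro open_meets_closure)
  then show ?thesis using that by auto
qed

text \<open>Uniform continuity of the semiflow on the compact set
  \<open>{0..L} \<times> UNIV\<close>.\<close>

lemma uniformly_close_orbits:
  assumes "e > 0"
  obtains \<eta> where "\<eta> > 0"
    "\<And>y z t. dist y z < \<eta> \<Longrightarrow> t \<in> {0..L} \<Longrightarrow> dist (f t y) (f t z) < e"
proof -
  have "uniformly_continuous_on ({0..L} \<times> UNIV) (\<lambda>z. f (fst z) (snd z))"
    using compact_space continuous_on_flow
    by (intro compact_uniformly_continuous compact_Times continuous_on_subset[OF continuous_on_flow])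
      auto
  then obtain \<eta> where \<eta>: "\<eta> > 0" "\<And>u v. u \<in> {0..L} \<times> UNIV \<Longrightarrow> v \<in> {0..L} \<times> UNIV \<Longrightarrow>
      dist v u < \<eta> \<Longrightarrow> dist (f (fst v) (snd v)) (f (fst u) (snd u)) < e"
    using assms unfolding uniformly_continuous_on_def by metis
  show ?thesis
  proof
    show "\<eta> > 0" by fact
    show "dist (f t y) (f t z) < e" if "dist y z < \<eta>" "t \<in> {0..L}" for y z t
      using \<eta>(2)[of "(t, z)" "(t, y)"] that by (simp add: dist_Pair_Pair)
  qed
qed

text \<open>At suitable late times \<open>p\<close> is within \<open>d\<close> of \<open>x'\<close>
  and \<open>c\<close> within \<open>d\<close> of \<open>M\<close>; since \<open>M\<close> has
  distance at least \<open>4 * d\<close> from \<open>x'\<close>, a gap of \<open>2 * d\<close>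
  remains.\<close>

lemma separation_near_minimal_center:
  assumes d: "d > 0" and M: "M \<subseteq> minimal_center f x" "flow_invariant f M" "M \<noteq> {}"
    and x': "x' \<in> minimal_center f x" "\<And>m. m \<in> M \<Longrightarrow> 4 * d \<le> dist x' m"
    and dense: "minimal_center f x \<subseteq> closure {y \<in> minimal_center f x. birkhoff_recurrent f y}"
    and V: "open V" "x' \<in> V"
  obtains p c where "p \<in> V" "c \<in> V" "\<exists>\<^sub>F t in at_top. 2 * d \<le> dist (f t p) (f t c)"
proof -
  define W where "W = V \<inter> ball x' d"
  have W: "open W" "x' \<in> W" using V d by (auto simp: W_def)
  then have "W \<inter> {y \<in> minimal_center f x. birkhoff_recurrent f y} \<noteq> {}"
    using dense x'(1) by (intro open_meets_closure) auto
  then obtain p where p: "p \<in> W" "birkhoff_recurrent f p" by blast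
  obtain L where L: "L \<ge> 0" "\<And>t. 0 \<le> t \<Longrightarrow> \<exists>s\<in>{0..L}. f (t + s) p \<in> W"
    using syndetic_return[OF p(2) W(1) p(1)] by blast
  obtain \<eta> where \<eta>: "\<eta> > 0"
    "\<And>y z t. dist y z < \<eta> \<Longrightarrow> t \<in> {0..L} \<Longrightarrow> dist (f t y) (f t z) < d"
    using uniformly_close_orbits[OF d] by blast
  obtain m where m: "m \<in> M" using M by blast
  \<comment> \<open>The witness \<open>c\<close> is \<open>f s x\<close>, a point of the orbit of
    \<open>x\<close> inside \<open>W\<close>.\<close>
  obtain s where s: "s \<ge> 0" "f s x \<in> W"
    using minimal_center_visited[OF x'(1) W order_refl] by blast
  have "\<exists>t\<ge>S. 2 * d \<le> dist (f t p) (f t (f s x))" for S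
  proof -
    \<comment> \<open>Time \<open>T\<close> for \<open>x\<close> is time
      \<open>T - s \<ge> max 0 S\<close> for \<open>c\<close>. Being \<open>\<eta>\<close>-close to
      \<open>m\<close> then, the motion stays within \<open>d\<close> of that of \<open>m\<close>,
      hence of \<open>M\<close>, for a duration \<open>L\<close>.\<close>
    obtain T where T: "T \<ge> s + max 0 S" "f T x \<in> ball m \<eta>"
      using minimal_center_visited[of m x "ball m \<eta>" "s + max 0 S"] m M \<eta>(1) s(1) by auto
    \<comment> \<open>The gaps between returns of \<open>p\<close> are at most \<open>L\<close>, so
      one return falls within this shadowing window.\<close>
    obtain r where r: "r \<in> {0..L}" "f (T - s + r) p \<in> W"
      using L(2)[of "T - s"] T(1) by force
    have "f (T - s + r) (f s x) = f r (f T x)"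
      using flow_add[of s "T - s + r" x] flow_add[of T r x] s(1) r(1) T(1) by simp
    then have "dist (f r m) (f (T - s + r) (f s x)) < d"
      using \<eta>(2)[of m "f T x" r] r T by simp
    moreover have "4 * d \<le> dist x' (f r m)"
      using x'(2) M m r by (auto simp: flow_invariant_def)
    moreover have "dist x' (f (T - s + r) p) < d" using r by (simp add: W_def)
    moreover have "dist x' (f r m) \<le> dist x' (f (T - s + r) p)
        + dist (f (T - s + r) p) (f (T - s + r) (f s x)) + dist (f r m) (f (T - s + r) (f s x))"
      using dist_triangle[of x' "f r m" "f (T - s + r) p"]
        dist_triangle2[of "f (T - s + r) p" "f r m" "f (T - s + r) (f s x)"] by linarith
    ultimately have "2 * d \<le> dist (f (T - s + r) p) (f (T - s + r) (f s x))" by linarith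
    then show ?thesis using T r by (intro exI[of _ "T - s + r"]) auto
  qed
  then have "\<exists>\<^sub>F t in at_top. 2 * d \<le> dist (f t p) (f t (f s x))"
    by (auto simp: frequently_def eventually_at_top_linorder)
  then show ?thesis using that p(1) s(2) by (auto simp: W_def)
qed

end

text \<open>Every eventually true \<open>P\<close> holds at some point where \<open>g\<close> is at
  least \<open>l\<close>, so each supremum in the infimum defining \<open>Limsup\<close> is at least
  \<open>l\<close>.\<close>

lemma le_Limsup_frequently:
  fixes g :: "'b \<Rightarrow> 'c::complete_linorder"
  assumes "\<exists>\<^sub>F t in F. l \<le> g t"
  shows "l \<le> Limsup F g"
  unfolding Limsup_def
proof (rule INF_greatest)
  fix P assume "P \<in> {P. eventually P F}"
  then obtain t where "l \<le> g t" "P t"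
    using frequently_ex[OF frequently_eventually_conj[OF assms]] by auto
  then show "l \<le> Sup (g ` Collect P)" by (auto intro: SUP_upper2)
qed

theorem theorem3p2:
  fixes f :: "real \<Rightarrow> 'a::metric_space \<Rightarrow> 'a" and x :: 'a
  assumes "compact (UNIV :: 'a set)"
    and "semiflow f"
    and "\<not> generic f (minimal_center f x)"
    and "minimal_center f x \<subseteq> closure {y \<in> minimal_center f x. birkhoff_recurrent f y}"
  shows "\<exists>\<epsilon>>0. \<forall>a. \<forall>x'\<in>minimal_center f x. \<forall>U. x' \<in> interior U \<longrightarrow>
           (\<exists>c\<in>U. Limsup at_top (\<lambda>t. ereal (dist (f t a) (f t c))) \<ge> ereal \<epsilon>)"
proof -
  interpret compact_semiflow f by unfold_locales (fact assms)+
  obtain M N where MN: "minimal_set f M" "minimal_set f N" "M \<inter> N = {}"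
    "M \<subseteq> minimal_center f x" "N \<subseteq> minimal_center f x"
    using two_minimal_sets[OF assms(3,4)] by blast
  have "M \<subseteq> \<Union>{- N}" using MN(3) by blast
  moreover have "open G" if "G \<in> {- N}" for G
    using that minimal_setD(2)[OF MN(2)] by (simp add: open_Compl)
  ultimately obtain \<delta> where \<delta>: "\<delta> > 0" "\<And>m. m \<in> M \<Longrightarrow> \<exists>G\<in>{- N}. ball m \<delta> \<subseteq> G"
    using Heine_Borel_lemma[OF compact_if_closed[OF minimal_setD(2)[OF MN(1)]], of "{- N}"] by metis
  have sep: "\<delta> \<le> dist m n" if "m \<in> M" "n \<in> N" for m n
  proof (rule ccontr)
    assume "\<not> \<delta> \<le> dist m n"
    then have "n \<in> ball m \<delta>" by simp
    then show False using \<delta>(2)[OF that(1)] that(2) by blast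
  qed
  \<comment> \<open>Then \<open>4 * d + 4 * d = \<delta>\<close>, so no point is closer than
    \<open>4 * d\<close> to both \<open>M\<close> and \<open>N\<close>. The choice involves neither
    \<open>a\<close> nor \<open>x'\<close> nor \<open>U\<close>.\<close>
  define d where "d = \<delta> / 8"
  have d: "d > 0" using \<delta>(1) by (simp add: d_def)
  have "\<exists>c\<in>U. Limsup at_top (\<lambda>t. ereal (dist (f t a) (f t c))) \<ge> ereal d"
    if x': "x' \<in> minimal_center f x" and U: "x' \<in> interior U" for a x' U
  proof -
    have "(\<forall>m\<in>M. 4 * d \<le> dist x' m) \<or> (\<forall>n\<in>N. 4 * d \<le> dist x' n)"
    proof (rule ccontr)
      assume "\<not> ?thesis"
      then obtain m n where mn: "m \<in> M" "n \<in> N" "dist x' m < 4 * d" "dist x' n < 4 * d"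
        by fastforce
      then show False
        using sep[OF mn(1,2)] dist_triangle3[of m n x'] by (simp add: d_def)
    qed
    then obtain K where K: "minimal_set f K" "K \<subseteq> minimal_center f x"
      "\<And>m. m \<in> K \<Longrightarrow> 4 * d \<le> dist x' m"
      using MN by blast
    then obtain p c where pc: "p \<in> interior U" "c \<in> interior U"
      and freq: "\<exists>\<^sub>F t in at_top. 2 * d \<le> dist (f t p) (f t c)"
      using separation_near_minimal_center[OF d K(2) minimal_setD(3)[OF K(1)] minimal_setD(1)[OF K(1)]
          x' K(3) assms(4) open_interior U] by blast
    \<comment> \<open>Whenever \<open>p\<close> and \<open>c\<close> are \<open>2 * d\<close> apart,
      the motion of \<open>a\<close> is at least \<open>d\<close> away from one of them.\<close>
    have "\<exists>\<^sub>F t in at_top. d \<le> dist (f t a) (f t p) \<or> d \<le> dist (f t a) (f t c)"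
      using freq
    proof (rule frequently_elim1)
      fix t assume "2 * d \<le> dist (f t p) (f t c)"
      then show "d \<le> dist (f t a) (f t p) \<or> d \<le> dist (f t a) (f t c)"
        using dist_triangle3[of "f t p" "f t c" "f t a"] by linarith
    qed
    \<comment> \<open>A disjunction that holds frequently has a disjunct that holds frequently, so a
      single \<open>q\<close> serves arbitrarily late times.\<close>
    then have "\<exists>q\<in>{p, c}. \<exists>\<^sub>F t in at_top. ereal d \<le> ereal (dist (f t a) (f t q))"
      by (simp add: frequently_disj_iff)
    then obtain q where q: "q \<in> {p, c}"
      and "\<exists>\<^sub>F t in at_top. ereal d \<le> ereal (dist (f t a) (f t q))" by blast
    note le_Limsup_frequently[OF this(2)]
    moreover have "q \<in> U" using q pc interior_subset[of U] by blast
    ultimately show ?thesis by blast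
  qed
  then show ?thesis using d by blast
qed

end
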